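(* Let $E$ be a Euclidean simple Jordan algebra with identity $e$ and associated irreducible symmetric cone $\Omega$. Let $w$ be a multiplication algorithm on $\Omega$ such that the map $\Omega\ni x\mapsto w(x)\in G$ is differentiable, and let $g=w^{-1}$ (i.e. $g(x)=w(x)^{-1}$). Suppose $X$ and $Y$ are independent $\Omega$-valued random variables whose (probability) densities are $$f_X(x)=C_X\,e_0(x)\exp\langle\Lambda,x\rangle\,I_\Omega(x),\qquad f_Y(x)=C_Y\,f_0(x)\exp\langle\Lambda,x\rangle\,I_\Omega(x),$$ where $C_X,C_Y$ are constants, $\Lambda\in E$, and $e_0,f_0$ are $w$-multiplicative functions. Then the random vector $(U,V)=\big(g(X+Y)X,\;X+Y\big)$ has independent components.
   Context: A Euclidean Jordan algebra is a finite-dimensional real inner product space $(E,\langle\cdot,\cdot\rangle)$ with a bilinear product $(x,y)\mapsto xy$ and unit $e$ such that $xy=yx$, $x(x^2y)=x^2(xy)$, $xe=x$, and $\langle x,yz\rangle=\langle xy,z\rangle$; it is simple if it is not a Cartesian product of two Euclidean Jordan algebras of positive dimension. The symmetric cone $\Omega$ is the interior of $\{x^2: x\in E\}$. $G$ denotes the connected component containing the identity of the group of linear automorphisms of $E$ preserving $\Omega$. A multiplication algorithm is a map $\Omega\to G$, $x\mapsto w(x)$, with $w(x)e=x$ for all $x\in\Omega$. A function $h\colon\Omega\to\mathbb{R}$ is $w$-logarithmic if $h(x)+h(w(e)y)=h(w(x)y)$ for all $(x,y)\in\Omega^2$; a function is $w$-multiplicative if it is of the form $e^{h}$ with $h$ $w$-logarithmic,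 i.e. $F\colon\Omega\to(0,\infty)$ with $F(x)F(w(e)y)=F(w(x)y)$. Lebesgue measure on $\Omega$ refers to that of the Euclidean space $E$. *)

theory Defs
  imports "HOL-Analysis.Analysis" "HOL-Probability.Probability"
begin

definition eja :: "('a::euclidean_space \<Rightarrow> 'a \<Rightarrow> 'a) \<Rightarrow> 'a \<Rightarrow> bool" where
  "eja m e \<longleftrightarrow> bilinear m
     \<and> (\<forall>x y. m x y = m y x)
     \<and> (\<forall>x y. m x (m (m x x) y) = m (m x x) (m x y))
     \<and> (\<forall>x. m x e = x)
     \<and> (\<forall>x y z. x \<bullet> m y z = m x y \<bullet> z)"

text \<open>Simple: E is not (isomorphic to) a Cartesian product of two Euclidean Jordan
algebras of positive dimension, i.e. E is not the direct sum of two nonzero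
subspaces A, B which are subalgebras with A B = 0.\<close>
definition simple_eja :: "('a::euclidean_space \<Rightarrow> 'a \<Rightarrow> 'a) \<Rightarrow> 'a \<Rightarrow> bool" where
  "simple_eja m e \<longleftrightarrow> eja m e \<and>
     \<not> (\<exists>A B. subspace A \<and> subspace B \<and> A \<noteq> {0} \<and> B \<noteq> {0}
              \<and> A \<inter> B = {0} \<and> (\<forall>z. \<exists>a\<in>A. \<exists>b\<in>B. z = a + b)
              \<and> (\<forall>a\<in>A. \<forall>a'\<in>A. m a a' \<in> A) \<and> (\<forall>b\<in>B. \<forall>b'\<in>B. m b b' \<in> B)
              \<and> (\<forall>a\<in>A. \<forall>b\<in>B. m a b = 0))"

definition sym_cone :: "('a::euclidean_space \<Rightarrow> 'a \<Rightarrow> 'a) \<Rightarrow> 'a set" where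
  "sym_cone m = interior {m x x | x. True}"

definition cone_group :: "('a::euclidean_space \<Rightarrow> 'a \<Rightarrow> 'a) \<Rightarrow> ('a \<Rightarrow>\<^sub>L 'a) set" where
  "cone_group m = connected_component_set
     {A :: 'a \<Rightarrow>\<^sub>L 'a. bij (blinfun_apply A) \<and> blinfun_apply A ` sym_cone m = sym_cone m}
     id_blinfun"

definition mult_algorithm ::
  "('a::euclidean_space \<Rightarrow> 'a \<Rightarrow> 'a) \<Rightarrow> 'a \<Rightarrow> ('a \<Rightarrow> ('a \<Rightarrow>\<^sub>L 'a)) \<Rightarrow> bool" where
  "mult_algorithm m e w \<longleftrightarrow>
     (\<forall>x\<in>sym_cone m. w x \<in> cone_group m \<and> blinfun_apply (w x) e = x)"

definition w_logarithmic ::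
  "('a::euclidean_space \<Rightarrow> 'a \<Rightarrow> 'a) \<Rightarrow> 'a \<Rightarrow> ('a \<Rightarrow> ('a \<Rightarrow>\<^sub>L 'a)) \<Rightarrow> ('a \<Rightarrow> real) \<Rightarrow> bool" where
  "w_logarithmic m e w h \<longleftrightarrow>
     (\<forall>x\<in>sym_cone m. \<forall>y\<in>sym_cone m. h x + h (w e y) = h (w x y))"

definition w_multiplicative ::
  "('a::euclidean_space \<Rightarrow> 'a \<Rightarrow> 'a) \<Rightarrow> 'a \<Rightarrow> ('a \<Rightarrow> ('a \<Rightarrow>\<^sub>L 'a)) \<Rightarrow> ('a \<Rightarrow> real) \<Rightarrow> bool" where
  "w_multiplicative m e w F \<longleftrightarrow>
     (\<exists>h. w_logarithmic m e w h \<and> (\<forall>x\<in>sym_cone m. F x = exp (h x)))"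

end

theory Submission
  imports Defs "HOL-Computational_Algebra.Polynomial"
begin

text \<open>For fixed \<open>V = v\<close> substitute \<open>x = w v u\<close> in the joint density. Since \<open>w v e = v\<close>, the second argument
  \<open>v - x\<close> becomes \<open>w v (e - u)\<close>, so multiplicativity splits the density into a function of \<open>v\<close> times a
  function of \<open>u\<close>; the Jacobian depends only on \<open>v\<close>.

  The Jordan structure enters only through closure of the cone under addition, so that \<open>w (x + y)\<close> is
  controlled by the hypotheses. Writing \<open>y = w x z\<close> gives \<open>x + y = w x (e + z)\<close>, which reduces this to
  \<open>e + a\<^sup>2\<close> being a square. By power associativity the root is \<open>q a\<close>, where the polynomial \<open>q\<close>
  interpolates \<open>sqrt (1 + t\<^sup>2)\<close> at the eigenvalues of the self-adjoint operator \<open>m a\<close>.\<close>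

section \<open>Spectral decomposition of self-adjoint operators, and interpolation\<close>

text \<open>A maximiser \<open>v\<close> of \<open>T x \<bullet> x\<close> on the unit sphere of
  \<open>W\<close> works: with \<open>l\<close> the maximum,
  \<open>l * (x \<bullet> x) - T x \<bullet> x\<close> is nonnegative on \<open>W\<close> and zero
  at \<open>v\<close>, so its first variation at \<open>v\<close> vanishes.\<close>

lemma self_adjoint_eigenvector:
  fixes T :: "'a::euclidean_space \<Rightarrow> 'a"
  assumes T: "linear T" and sym: "\<And>x y. T x \<bullet> y = x \<bullet> T y"
    and W: "subspace W" "W \<noteq> {0}" and inv: "\<And>x. x \<in> W \<Longrightarrow> T x \<in> W"
  obtains v l where "v \<in> W" "v \<noteq> 0" "T v = l *\<^sub>R v"
proof -
  obtain w where w: "w \<in> W" "w \<noteq> 0"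
    using W subspace_0 by blast
  have "compact (sphere 0 1 \<inter> W)"
    using W by (intro compact_Int_closed closed_subspace) auto
  moreover have "w /\<^sub>R norm w \<in> sphere 0 1 \<inter> W"
    using w W by (auto simp: subspace_scale)
  moreover have "continuous_on (sphere 0 1 \<inter> W) (\<lambda>x. T x \<bullet> x)"
    using T by (intro continuous_on_inner continuous_on_id linear_continuous_on)
      (simp add: linear_conv_bounded_linear)
  ultimately have "\<exists>v\<in>sphere 0 1 \<inter> W. \<forall>x\<in>sphere 0 1 \<inter> W. T x \<bullet> x \<le> T v \<bullet> v"
    by (intro continuous_attains_sup) blast+
  then obtain v where v: "v \<in> sphere 0 1" "v \<in> W"
    and max: "\<And>x. x \<in> sphere 0 1 \<inter> W \<Longrightarrow> T x \<bullet> x \<le> T v \<bullet> v"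
    by blast
  define l where "l = T v \<bullet> v"
  have vv: "v \<bullet> v = 1"
    using v by (simp add: dot_square_norm)
  have nonneg: "0 \<le> l * (x \<bullet> x) - T x \<bullet> x" if "x \<in> W" for x
  proof (cases "x = 0")
    case False
    then have "x /\<^sub>R norm x \<in> sphere 0 1 \<inter> W"
      using that W by (auto simp: subspace_scale)
    from max[OF this] have "(T x \<bullet> x) / (norm x)\<^sup>2 \<le> l"
      using T by (simp add: l_def linear_cmul power2_eq_square divide_simps)
    then show ?thesis
      using False by (simp add: divide_simps dot_square_norm mult.commute)
  qed (use T in \<open>simp add: linear_0\<close>)
  \<comment> \<open>Moving from \<open>v\<close> to \<open>v + t *\<^sub>R y\<close> along this
    residual changes the form at first order by \<open>2 * t * (y \<bullet> y)\<close>; a small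
    negative \<open>t\<close> then forces \<open>y = 0\<close>.\<close>
  define y where "y = l *\<^sub>R v - T v"
  have y: "y \<in> W"
    using v W inv by (simp add: y_def subspace_diff subspace_scale)
  define Q where "Q = l * (y \<bullet> y) - T y \<bullet> y"
  have quad: "0 \<le> 2 * t * (y \<bullet> y) + t\<^sup>2 * Q" for t
  proof -
    have "0 \<le> l * ((v + t *\<^sub>R y) \<bullet> (v + t *\<^sub>R y)) - T (v + t *\<^sub>R y) \<bullet> (v + t *\<^sub>R y)"
      using y v W by (intro nonneg) (simp add: subspace_add subspace_scale)
    also have "\<dots> = l * (v \<bullet> v) - T v \<bullet> v + 2 * t * (l * (v \<bullet> y) - T v \<bullet> y) + t\<^sup>2 * Q"
      using T sym[of v y]
      by (simp add: linear_add linear_cmul inner_left_distrib inner_right_distrib Q_def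
          inner_commute[of y v] inner_commute[of "T y" v] distrib_left power2_eq_square)
        (simp add: algebra_simps)
    also have "l * (v \<bullet> y) - T v \<bullet> y = y \<bullet> y"
      by (simp add: y_def inner_diff_left)
    finally show ?thesis
      by (simp add: l_def vv)
  qed
  have "y \<bullet> y \<le> 0"
  proof (rule ccontr)
    assume "\<not> y \<bullet> y \<le> 0"
    then have pos: "0 < y \<bullet> y" by (simp only: not_le)
    \<comment> \<open>This size keeps \<open>\<bar>t * Q\<bar>\<close> at most
      \<open>y \<bullet> y\<close>, so the linear term wins; the \<open>+ 1\<close> covers
      \<open>Q = 0\<close>.\<close>
    define t where "t = - (y \<bullet> y) / (\<bar>Q\<bar> + 1)"
    have t: "t < 0"
      unfolding t_def using pos by (intro divide_neg_pos) linarith+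
    have "- t * Q \<le> y \<bullet> y"
    proof -
      have "- t * Q \<le> - t * (\<bar>Q\<bar> + 1)"
        using t by (intro mult_left_mono) auto
      also have "\<dots> = y \<bullet> y"
        by (simp add: t_def)
      finally show ?thesis .
    qed
    then have "0 < 2 * (y \<bullet> y) + t * Q"
      using pos by linarith
    then have "t * (2 * (y \<bullet> y) + t * Q) < 0"
      using t by (simp add: mult_neg_pos)
    then show False
      using quad[of t] by (simp add: algebra_simps power2_eq_square)
  qed
  then have "y = 0" by (metis antisym inner_eq_zero_iff inner_ge_zero)
  then have "T v = l *\<^sub>R v"
    by (simp add: y_def)
  moreover have "v \<noteq> 0"
    using vv by auto
  ultimately show thesis
    using that v by blast
qed

text \<open>The orthogonal complement of all eigenvectors is invariant by self-adjointness; if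
  nonzero, it would contain an eigenvector, which would be orthogonal to itself.\<close>

lemma self_adjoint_span_eigenvectors:
  fixes T :: "'a::euclidean_space \<Rightarrow> 'a"
  assumes T: "linear T" and sym: "\<And>x y. T x \<bullet> y = x \<bullet> T y"
  shows "span {v. \<exists>l. T v = l *\<^sub>R v} = UNIV"
proof (rule ccontr)
  let ?E = "{v. \<exists>l. T v = l *\<^sub>R v}"
  define W where "W = {x. \<forall>v\<in>?E. v \<bullet> x = 0}"
  assume "span ?E \<noteq> UNIV"
  then obtain x where x: "x \<notin> span ?E" by blast
  obtain y z where yz: "y \<in> span ?E" "\<And>w. w \<in> span ?E \<Longrightarrow> orthogonal z w" "x = y + z"
    using orthogonal_subspace_decomp_exists[of ?E x] by blast
  have "z \<in> W"
    using yz(2) span_base[of _ ?E] by (auto simp: W_def orthogonal_def inner_commute)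
  moreover have "z \<noteq> 0"
    using x yz by auto
  ultimately have "W \<noteq> {0}" by blast
  moreover have "subspace W"
    by (auto simp: W_def subspace_def inner_right_distrib)
  moreover have "T u \<in> W" if "u \<in> W" for u
  proof -
    have "v \<bullet> T u = 0" if "T v = l *\<^sub>R v" for v l
      using sym[of v u] that \<open>u \<in> W\<close> by (auto simp: W_def)
    then show ?thesis by (auto simp: W_def)
  qed
  ultimately obtain v l where "v \<in> W" "v \<noteq> 0" "T v = l *\<^sub>R v"
    using self_adjoint_eigenvector[OF T sym] by metis
  then show False
    by (auto simp: W_def)
qed

text \<open>Newton's scheme: a multiple of the polynomial vanishing at the old nodes corrects the
  value at the new one.\<close>

lemma poly_interpolation:
  fixes f :: "'a::field \<Rightarrow> 'a"
  assumes "finite S"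
  shows "\<exists>p. \<forall>x\<in>S. poly p x = f x"
  using assms
proof (induction S)
  case (insert a S)
  then obtain p where p: "\<forall>x\<in>S. poly p x = f x" by blast
  define r where "r = (\<Prod>s\<in>S. [:- s, 1:])"
  have r: "poly r x = (\<Prod>s\<in>S. x - s)" for x
    by (simp add: r_def poly_prod)
  have "poly (p + smult ((f a - poly p a) / poly r a) r) x = f x" if "x \<in> insert a S" for x
  proof (cases "x = a")
    case True
    have "poly r a \<noteq> 0"
      using insert by (auto simp: r)
    with True show ?thesis by simp
  next
    case False
    then have "poly r x = 0"
      using that insert by (auto simp: r)
    with False that p show ?thesis by simp
  qed
  then show ?case by blast
qed simp

section \<open>Power associativity and a square root of \<open>e + m a a\<close>\<close>

text \<open>Without associativity a bracketing must be fixed. This one iterates the operator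
  \<open>m a\<close> on \<open>e\<close>, so powers can be read off an eigenvector expansion of
  \<open>e\<close>.\<close>

primrec jpow :: "('a \<Rightarrow> 'a \<Rightarrow> 'a) \<Rightarrow> 'a \<Rightarrow> 'a \<Rightarrow> nat \<Rightarrow> 'a" where
  "jpow m e a 0 = e"
| "jpow m e a (Suc n) = m a (jpow m e a n)"

text \<open>Polarisation of the Jordan identity. The defect \<open>D\<close> is cubic and vanishes
  identically; \<open>D (x + z) - D (x - z) - 2 *\<^sub>R D z\<close> extracts twice its part linear
  in \<open>z\<close>.\<close>

lemma eja_linearized_identity:
  assumes "eja m e"
  shows "m z (m (m x x) y) + 2 *\<^sub>R m x (m (m x z) y) =
    2 *\<^sub>R m (m x z) (m x y) + m (m x x) (m z y)"
proof -
  have bil: "bilinear m" and comm: "\<And>x y. m x y = m y x"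
    and jordan: "\<And>x y. m x (m (m x x) y) = m (m x x) (m x y)"
    using assms unfolding eja_def by auto
  note b = bilinear_ladd[OF bil] bilinear_radd[OF bil] bilinear_lsub[OF bil] bilinear_rsub[OF bil]
  define D where "D u = m u (m (m u u) y) - m (m u u) (m u y)" for u
  have "D (x + z) - D (x - z) - 2 *\<^sub>R D z =
    2 *\<^sub>R (m z (m (m x x) y) + 2 *\<^sub>R m x (m (m x z) y) -
      (2 *\<^sub>R m (m x z) (m x y) + m (m x x) (m z y)))"
    by (simp add: D_def b comm[of z x] scaleR_2 algebra_simps)
  then show ?thesis
    by (simp add: D_def jordan)
qed

text \<open>The linearized identity writes multiplication by the power \<open>n + 2\<close> through
  multiplications by \<open>a\<close>, \<open>m a a\<close> and the powers \<open>n\<close> and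
  \<open>n + 1\<close>. All of these commute with \<open>m a\<close>, hence an induction on pairs of
  consecutive powers.\<close>

lemma eja_jpow_commute:
  assumes "eja m e"
  shows "m (jpow m e a n) (m a y) = m a (m (jpow m e a n) y)"
proof -
  have bil: "bilinear m" and comm: "\<And>x y. m x y = m y x"
    and jordan: "\<And>x y. m x (m (m x x) y) = m (m x x) (m x y)"
    and unit: "\<And>x. m x e = x"
    using assms unfolding eja_def by auto
  note b = bilinear_ladd[OF bil] bilinear_radd[OF bil] bilinear_lsub[OF bil] bilinear_rsub[OF bil]
    bilinear_lmul[OF bil] bilinear_rmul[OF bil]
  have step: "m (m (m a a) u) z =
    2 *\<^sub>R m (m a u) (m a z) + m (m a a) (m u z) - 2 *\<^sub>R m a (m u (m a z))" for u z
    using eja_linearized_identity[OF assms, of z a u]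
    by (simp add: comm[of z] comm[of "m a z"] algebra_simps)
  have sq: "m (m a a) (jpow m e a n) = jpow m e a (Suc (Suc n))" for n
    by (induction n) (auto simp: unit jordan[symmetric])
  have "(\<forall>y. m (jpow m e a n) (m a y) = m a (m (jpow m e a n) y)) \<and>
    (\<forall>y. m (jpow m e a (Suc n)) (m a y) = m a (m (jpow m e a (Suc n)) y))" for n
  proof (induction n)
    case 0
    then show ?case by (simp add: unit comm[of e])
  next
    case (Suc n)
    have "m (jpow m e a (Suc (Suc n))) (m a y) = m a (m (jpow m e a (Suc (Suc n))) y)" for y
      using Suc unfolding sq[symmetric] step by (simp add: b jordan)
    with Suc show ?case by blast
  qed
  then show ?thesis by blast
qed

text \<open>Power associativity: by the commutation above, each factor \<open>a\<close> of the right
  argument can be pulled out in front.\<close>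

lemma eja_jpow_add:
  assumes "eja m e"
  shows "m (jpow m e a i) (jpow m e a j) = jpow m e a (i + j)"
  using assms by (induction j) (auto simp: eja_jpow_commute eja_def)

text \<open>Expanding \<open>e\<close> in eigenvectors of \<open>m a\<close> shows that a polynomial
  in \<open>a\<close> depends only on its values at the eigenvalues involved. Power associativity
  makes \<open>m b b\<close> the polynomial \<open>q\<^sup>2\<close> in \<open>a\<close>, which
  agrees there with \<open>1 + t\<^sup>2\<close>.\<close>

lemma eja_e_plus_square:
  fixes m :: "'a::euclidean_space \<Rightarrow> 'a \<Rightarrow> 'a"
  assumes "eja m e"
  shows "\<exists>b. m b b = e + m a a"
proof -
  have bil: "bilinear m" and comm: "\<And>x y. m x y = m y x"
    and unit: "\<And>x. m x e = x" and assoc: "\<And>x y z. x \<bullet> m y z = m x y \<bullet> z"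
    using assms unfolding eja_def by auto
  have lin: "linear (m a)" for a
    using bil by (simp add: bilinear_def)
  have "m a x \<bullet> y = x \<bullet> m a y" for x y
    by (metis assoc comm)
  from self_adjoint_span_eigenvectors[OF lin this] obtain F r where
    F: "finite F" "F \<subseteq> {v. \<exists>l. m a v = l *\<^sub>R v}" and e0: "e = (\<Sum>v\<in>F. r v *\<^sub>R v)"
    unfolding span_explicit by blast
  have "\<forall>v\<in>F. \<exists>l. m a v = l *\<^sub>R v"
    using F(2) by auto
  from bchoice[OF this] obtain l where l: "\<And>v. v \<in> F \<Longrightarrow> m a v = l v *\<^sub>R v"
    by blast
  have pow: "jpow m e a n = (\<Sum>v\<in>F. (r v * l v ^ n) *\<^sub>R v)" for n
  proof (induction n)
    case (Suc n)
    then show ?case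
      by (simp add: linear_sum[OF lin] linear_cmul[OF lin] l algebra_simps)
  qed (simp add: e0[symmetric])
  obtain q where q: "\<forall>x\<in>l ` F. poly q x = sqrt (1 + x\<^sup>2)"
    using poly_interpolation[of "l ` F" "\<lambda>x. sqrt (1 + x\<^sup>2)"] F(1) by blast
  define b where "b = (\<Sum>i\<le>degree q. coeff q i *\<^sub>R jpow m e a i)"
  have "m b b = (\<Sum>i\<le>degree q. \<Sum>j\<le>degree q. (coeff q i * coeff q j) *\<^sub>R jpow m e a (i + j))"
    unfolding b_def bilinear_sum[OF bil] sum.cartesian_product
    by (simp add: bilinear_lmul[OF bil] bilinear_rmul[OF bil] eja_jpow_add[OF assms] mult.commute)
  also have "\<dots> = (\<Sum>v\<in>F. \<Sum>i\<le>degree q. \<Sum>j\<le>degree q.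
      (coeff q i * coeff q j * (r v * l v ^ (i + j))) *\<^sub>R v)"
    unfolding pow scaleR_sum_right
    by (subst (2) sum.swap, subst sum.swap) simp
  also have "\<dots> = (\<Sum>v\<in>F. (r v * (poly q (l v))\<^sup>2) *\<^sub>R v)"
    by (simp add: poly_altdef power2_eq_square sum_product sum_distrib_left scaleR_sum_left power_add
        mult_ac)
  also have "\<dots> = (\<Sum>v\<in>F. (r v * (1 + (l v)\<^sup>2)) *\<^sub>R v)"
    using q by (intro sum.cong) auto
  also have "\<dots> = jpow m e a 0 + jpow m e a 2"
    unfolding pow by (simp add: sum.distrib algebra_simps)
  also have "\<dots> = e + m a a"
    by (simp add: numeral_2_eq_2 unit)
  finally show ?thesis by blast
qed

section \<open>Closure of the cone under addition\<close>

text \<open>The translate of the cone by \<open>e\<close> is open and consists of squares, so it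
  lies in the interior of the set of squares.\<close>

lemma sym_cone_e_plus:
  assumes "eja m e" "z \<in> sym_cone m"
  shows "e + z \<in> sym_cone m"
proof -
  have "(+) e ` sym_cone m \<subseteq> {m x x |x. True}"
  proof safe
    fix z assume "z \<in> sym_cone m"
    then obtain a where "z = m a a"
      using interior_subset unfolding sym_cone_def by blast
    then show "\<exists>x. e + z = m x x \<and> True"
      using eja_e_plus_square[OF assms(1), of a] by metis
  qed
  moreover have "open ((+) e ` sym_cone m)"
    by (intro open_translation) (simp add: sym_cone_def)
  ultimately show ?thesis
    using assms(2) interior_maximal unfolding sym_cone_def by blast
qed

lemma mult_algorithm_bij:
  assumes "mult_algorithm m e w" "x \<in> sym_cone m"
  shows "bij (w x)" "w x ` sym_cone m = sym_cone m" "w x e = x"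
  using assms connected_component_subset
  unfolding mult_algorithm_def cone_group_def by blast+

lemma sym_cone_add:
  assumes "eja m e" "mult_algorithm m e w" "x \<in> sym_cone m" "y \<in> sym_cone m"
  shows "x + y \<in> sym_cone m"
proof -
  note w = mult_algorithm_bij[OF assms(2,3)]
  obtain z where z: "z \<in> sym_cone m" "y = w x z"
    using w(2) assms(4) by blast
  have "x + y = w x (e + z)"
    by (simp add: blinfun.add_right w z)
  then show ?thesis
    using w(2) sym_cone_e_plus[OF assms(1) z(1)] by blast
qed

section \<open>Joint continuity of the inverse, and linear change of variables\<close>

text \<open>An invertible \<open>w v\<close> is bounded below by some \<open>c\<close>, and nearby
  operators by \<open>c / 2\<close>. So the inverse at \<open>q\<close> differs from
  \<open>a\<close> by at most \<open>2 / c\<close> times the residual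
  \<open>snd q - w (fst q) a\<close>, which tends to 0. Joint continuity is what later yields
  measurability in both arguments.\<close>

lemma continuous_on_inv_blinfun:
  fixes w :: "'a::topological_space \<Rightarrow> 'b::euclidean_space \<Rightarrow>\<^sub>L 'b"
  assumes w: "continuous_on S w" and bij: "\<And>v. v \<in> S \<Longrightarrow> bij (w v)"
  shows "continuous_on (S \<times> UNIV) (\<lambda>(v, x). inv (w v) x)"
  unfolding continuous_on_def
proof (intro ballI)
  fix p assume "p \<in> S \<times> (UNIV :: 'b set)"
  then obtain v x where p: "p = (v, x)" and v: "v \<in> S" by auto
  let ?F = "at p within S \<times> (UNIV :: 'b set)"
  define a where "a = inv (w v) x"
  have inv: "w u (inv (w u) y) = y" if "u \<in> S" for u y
    using bij[OF that] by (simp add: bij_is_surj surj_f_inv_f)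
  have "linear (w v)"
    by (simp add: blinfun.bounded_linear_right bounded_linear.linear)
  then obtain c where c: "c > 0" "\<And>y. c * norm y \<le> norm (w v y)"
    using linear_inj_bounded_below_pos[of "w v"] bij[OF v] by (auto simp: bij_is_inj)
  have S: "\<forall>\<^sub>F q in ?F. q \<in> S \<times> UNIV"
    by (simp add: eventually_at_filter)
  have "continuous_on (S \<times> (UNIV :: 'b set)) (\<lambda>q. w (fst q))"
    by (rule continuous_on_compose2[OF w]) (auto intro: continuous_intros)
  then have lim: "((\<lambda>q. w (fst q)) \<longlongrightarrow> w v) ?F"
    using v unfolding continuous_on_def p by force
  then have near: "\<forall>\<^sub>F q in ?F. dist (w (fst q)) (w v) < c / 2"
    using c(1) by (intro tendstoD) auto
  have "\<forall>\<^sub>F q in ?F. norm (inv (w (fst q)) (snd q) - a) \<le> 2 / c * norm (snd q - w (fst q) a)"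
    using near S
  proof eventually_elim
    case (elim q)
    define d where "d = inv (w (fst q)) (snd q) - a"
    have "c * norm d \<le> norm (w v d)"
      by (rule c)
    also have "w v d = w (fst q) d - (w (fst q) - w v) d"
      by (simp add: blinfun.diff_left)
    also have "norm \<dots> \<le> norm (w (fst q) d) + norm ((w (fst q) - w v) d)"
      by (rule norm_triangle_ineq4)
    also have "norm ((w (fst q) - w v) d) \<le> c / 2 * norm d"
      using elim(1) norm_blinfun[of "w (fst q) - w v" d]
      by (smt (verit) dist_norm mult_right_mono norm_ge_zero)
    also have "w (fst q) d = snd q - w (fst q) a"
      using elim(2) by (auto simp: d_def blinfun.diff_right inv)
    finally show ?case
      using c(1) by (simp add: d_def field_simps)
  qed
  moreover have "((\<lambda>q. 2 / c * norm (snd q - w (fst q) a)) \<longlongrightarrow> 2 / c * norm (snd p - w v a)) ?F"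
    by (intro tendsto_intros lim)
  then have "((\<lambda>q. 2 / c * norm (snd q - w (fst q) a)) \<longlongrightarrow> 0) ?F"
    using v by (simp add: p a_def inv)
  ultimately have "((\<lambda>q. inv (w (fst q)) (snd q) - a) \<longlongrightarrow> 0) ?F"
    by (rule Lim_null_comparison)
  then show "((\<lambda>(v, x). inv (w v) x) \<longlongrightarrow> (case p of (v, x) \<Rightarrow> inv (w v) x)) ?F"
    by (simp add: case_prod_unfold p a_def Lim_null[symmetric])
qed

lemma nn_integral_lborel_shift:
  fixes f :: "'a::euclidean_space \<Rightarrow> ennreal"
  assumes [measurable]: "f \<in> borel_measurable borel"
  shows "(\<integral>\<^sup>+x. f (a + x) \<partial>lborel) = (\<integral>\<^sup>+x. f x \<partial>lborel)"
  by (subst (2) lborel_distr_plus[of a, symmetric]) (simp add: nn_integral_distr)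

text \<open>Uniqueness of Haar measure by Tonelli's theorem: it replaces the determinant formula, and the
  Jacobian comes out as an integral that is visibly measurable in parameters.\<close>

lemma nn_integral_lborel_linear:
  fixes g :: "'a::euclidean_space \<Rightarrow> 'a" and f :: "'a \<Rightarrow> ennreal"
  assumes g: "linear g" "surj g" and [measurable]: "f \<in> borel_measurable borel" "C \<in> sets borel"
    and C: "emeasure lborel C = 1"
  shows "(\<integral>\<^sup>+x. f (g x) \<partial>lborel) =
    (\<integral>\<^sup>+x. indicator C (- g x) \<partial>lborel) * (\<integral>\<^sup>+x. f x \<partial>lborel)"
proof -
  have [measurable]: "g \<in> borel_measurable borel"
    using g(1) by (intro borel_measurable_continuous_onI linear_continuous_on)
      (simp add: linear_conv_bounded_linear)
  \<comment> \<open>A factor 1, written as the mass of a translate of \<open>C\<close>, introduces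
    the second variable for Tonelli.\<close>
  have "(\<integral>\<^sup>+y. indicator C (y - g x) \<partial>lborel) = 1" for x
    using nn_integral_lborel_shift[of "indicator C" "- g x"] C by (simp add: nn_integral_indicator)
  then have "(\<integral>\<^sup>+x. f (g x) \<partial>lborel) =
      (\<integral>\<^sup>+x. \<integral>\<^sup>+y. f (g x) * indicator C (y - g x) \<partial>lborel \<partial>lborel)"
    by (simp add: nn_integral_cmult)
  also have "\<dots> = (\<integral>\<^sup>+y. \<integral>\<^sup>+x. f (g x) * indicator C (y - g x) \<partial>lborel \<partial>lborel)"
    by (rule lborel_pair.Fubini'[symmetric]) measurable
  \<comment> \<open>Writing \<open>y = g a\<close> and translating \<open>x\<close> by
    \<open>a\<close> moves \<open>y\<close> from the indicator into \<open>f\<close>; after another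
    exchange, translating \<open>y\<close> by \<open>g x\<close> decouples the two factors.\<close>
  also have "\<dots> = (\<integral>\<^sup>+y. \<integral>\<^sup>+x. f (g x + y) * indicator C (- g x) \<partial>lborel \<partial>lborel)"
  proof (rule nn_integral_cong)
    fix y
    obtain a where "y = g a"
      using g(2) by (meson surjD)
    then show "(\<integral>\<^sup>+x. f (g x) * indicator C (y - g x) \<partial>lborel) =
        (\<integral>\<^sup>+x. f (g x + y) * indicator C (- g x) \<partial>lborel)"
      using nn_integral_lborel_shift[of "\<lambda>x. f (g x) * indicator C (y - g x)" a] g(1)
      by (simp add: linear_add add.commute)
  qed
  also have "\<dots> = (\<integral>\<^sup>+x. \<integral>\<^sup>+y. f (g x + y) * indicator C (- g x) \<partial>lborel \<partial>lborel)"
    by (rule lborel_pair.Fubini') measurable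
  also have "\<dots> = (\<integral>\<^sup>+x. (\<integral>\<^sup>+y. f y \<partial>lborel) * indicator C (- g x) \<partial>lborel)"
    using nn_integral_lborel_shift[of f]
    by (intro nn_integral_cong) (simp add: nn_integral_multc)
  finally show ?thesis
    by (simp add: nn_integral_cmult mult.commute)
qed

section \<open>Independence from a factorised density\<close>

text \<open>The set functions \<open>a\<close> and \<open>b\<close> may be unnormalised: whole
  spaces give \<open>a (space S) * b (space T) = 1\<close>, which is exactly what the product of the
  two marginals leaves over.\<close>

lemma (in prob_space) indep_var_factorI:
  assumes [measurable]: "random_variable S U" "random_variable T V"
    and factor: "\<And>A B. A \<in> sets S \<Longrightarrow> B \<in> sets T \<Longrightarrow>
      emeasure M {\<omega> \<in> space M. U \<omega> \<in> A \<and> V \<omega> \<in> B} = a A * b B"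
  shows "indep_var S U T V"
proof -
  interpret U: prob_space "distr M S U" by (rule prob_space_distr) fact
  interpret V: prob_space "distr M T V" by (rule prob_space_distr) fact
  have A: "{\<omega> \<in> space M. U \<omega> \<in> A} = {\<omega> \<in> space M. U \<omega> \<in> A \<and> V \<omega> \<in> space T}" for A
    using measurable_space[OF assms(2)] by auto
  have B: "{\<omega> \<in> space M. V \<omega> \<in> B} = {\<omega> \<in> space M. U \<omega> \<in> space S \<and> V \<omega> \<in> B}" for B
    using measurable_space[OF assms(1)] by auto
  have "{\<omega> \<in> space M. U \<omega> \<in> space S \<and> V \<omega> \<in> space T} = space M"
    using measurable_space[OF assms(1)] measurable_space[OF assms(2)] by auto
  then have total: "a (space S) * b (space T) = 1"
    using factor[of "space S" "space T"] by (simp add: emeasure_space_1)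
  have "distr M S U \<Otimes>\<^sub>M distr M T V = distr M (S \<Otimes>\<^sub>M T) (\<lambda>x. (U x, V x))"
  proof (rule pair_measure_eqI)
    fix A B assume "A \<in> sets (distr M S U)" "B \<in> sets (distr M T V)"
    then have [measurable]: "A \<in> sets S" "B \<in> sets T" by auto
    have "emeasure (distr M S U) A * emeasure (distr M T V) B =
        (a A * b (space T)) * (a (space S) * b B)"
      using factor[of A "space T"] factor[of "space S" B]
      by (simp add: emeasure_distr vimage_def Int_def conj_commute A B)
    also have "\<dots> = a A * b B * (a (space S) * b (space T))"
      by (simp add: mult_ac)
    also have "\<dots> = emeasure (distr M (S \<Otimes>\<^sub>M T) (\<lambda>x. (U x, V x))) (A \<times> B)"
      using factor[of A B] total by (simp add: emeasure_distr vimage_def Int_def conj_commute)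
    finally show "emeasure (distr M S U) A * emeasure (distr M T V) B =
      emeasure (distr M (S \<Otimes>\<^sub>M T) (\<lambda>x. (U x, V x))) (A \<times> B)" .
  qed (auto intro: U.sigma_finite_measure_axioms V.sigma_finite_measure_axioms)
  then show ?thesis
    by (simp add: indep_var_distribution_eq)
qed

text \<open>The analytic core, free of Jordan structure: on the fibre of sum \<open>v\<close>, the
  linear substitution \<open>x = w v u\<close> reduces independence to the splitting
  \<open>factor\<close> of the joint density.\<close>

lemma (in prob_space) indep_var_density_factor:
  fixes X Y :: "'a \<Rightarrow> 'b::euclidean_space" and w :: "'b \<Rightarrow> 'b \<Rightarrow>\<^sub>L 'b" and P Q r H :: "'b \<Rightarrow> ennreal"
  assumes S: "open S" "continuous_on S w" "\<And>v. v \<in> S \<Longrightarrow> bij (w v)"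
    and X: "distributed M lborel X P" and Y: "distributed M lborel Y Q"
    and indep: "indep_var borel X borel Y"
    and sum: "\<And>\<omega>. \<omega> \<in> space M \<Longrightarrow> X \<omega> + Y \<omega> \<in> S"
    and [measurable]: "r \<in> borel_measurable borel" "H \<in> borel_measurable borel"
    and factor: "\<And>v u. v \<in> S \<Longrightarrow> P (w v u) * Q (v - w v u) = r v * H u"
    and zero: "\<And>v x. v \<notin> S \<Longrightarrow> P x * Q (v - x) = 0"
  shows "indep_var borel (\<lambda>\<omega>. inv (w (X \<omega> + Y \<omega>)) (X \<omega>)) borel (\<lambda>\<omega>. X \<omega> + Y \<omega>)"
proof -
  \<comment> \<open>The default 0 off the open set \<open>S\<close> makes \<open>g\<close> jointly
    Borel on the whole space; sums always lie in \<open>S\<close>.\<close>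
  define g where "g v x = (if v \<in> S then inv (w v) x else 0)" for v x
  have [measurable]: "S \<in> sets borel"
    using S by simp
  have [measurable]: "P \<in> borel_measurable borel" "Q \<in> borel_measurable borel"
      "X \<in> borel_measurable M" "Y \<in> borel_measurable M"
    using X Y by (auto simp: distributed_def)
  have "(\<lambda>z. if z \<in> S \<times> UNIV then (case z of (v, x) \<Rightarrow> inv (w v) x) else 0) \<in> borel_measurable borel"
    using S by (intro borel_measurable_continuous_on_if continuous_on_inv_blinfun continuous_on_const
      borel_open open_Times open_UNIV)
  also have "(\<lambda>z. if z \<in> S \<times> UNIV then (case z of (v, x) \<Rightarrow> inv (w v) x) else 0) = (\<lambda>(v, x). g v x)"
    by (auto simp: g_def fun_eq_iff)
  finally have g[measurable]: "case_prod g \<in> borel_measurable (borel \<Otimes>\<^sub>M borel)"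
    by (simp add: borel_prod)
  define C :: "'b set" where "C = cbox 0 One"
  have C: "emeasure lborel C = 1"
    by (simp add: C_def emeasure_lborel_cbox_eq)
  have [measurable]: "C \<in> sets borel"
    by (simp add: C_def)
  \<comment> \<open>For \<open>v\<close> in \<open>S\<close> this is the Jacobian, the absolute
    determinant of \<open>w v\<close>. Off \<open>S\<close> it is infinite, because \<open>0\<close>
    lies in \<open>C\<close>; there \<open>indicator S v\<close> cancels it, as 0 times infinity is
    0 in \<open>ennreal\<close>.\<close>
  define c where "c v = (\<integral>\<^sup>+x. indicator C (- g v x) \<partial>lborel)" for v
  have [measurable]: "c \<in> borel_measurable borel"
    unfolding c_def by measurable
  have fibre: "(\<integral>\<^sup>+x. P x * Q (v - x) * indicator A (g v x) \<partial>lborel) =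
      (indicator S v * c v * r v) * (\<integral>\<^sup>+u. H u * indicator A u \<partial>lborel)"
    if [measurable]: "A \<in> sets borel" for A v
  proof (cases "v \<in> S")
    case True
    note bij = S(3)[OF True]
    have g_v: "w v (g v x) = x" for x
      using bij True by (simp add: g_def bij_is_surj surj_f_inv_f)
    have "linear (w v)"
      by (simp add: blinfun.bounded_linear_right bounded_linear.linear)
    then have "linear (g v)"
      using bij True inj_linear_imp_inv_linear[of "w v"] by (simp add: g_def[abs_def] bij_is_inj)
    moreover have "surj (g v)"
      using bij True by (simp add: g_def[abs_def] bij_imp_bij_inv bij_is_surj)
    moreover have [measurable]: "blinfun_apply (w v) \<in> borel_measurable borel"
      by (intro borel_measurable_continuous_onI linear_continuous_on blinfun.bounded_linear_right)
    ultimately have "(\<integral>\<^sup>+x. (\<lambda>u. P (w v u) * Q (v - w v u) * indicator A u) (g v x) \<partial>lborel) =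
      c v * (\<integral>\<^sup>+u. P (w v u) * Q (v - w v u) * indicator A u \<partial>lborel)"
      unfolding c_def by (intro nn_integral_lborel_linear C) measurable
    then show ?thesis
      using True by (simp add: g_v factor nn_integral_cmult mult.assoc)
  qed (simp add: zero)
  have joint: "distributed M (lborel \<Otimes>\<^sub>M lborel) (\<lambda>\<omega>. (X \<omega>, Y \<omega>)) (\<lambda>(x, y). P x * Q y)"
  proof (rule distributed_joint_indep[OF _ _ X Y])
    show "indep_var lborel X lborel Y"
      using indep unfolding indep_var_eq by (simp cong: measurable_cong_sets)
  qed (rule sigma_finite_lborel)+
  have "indep_var borel (\<lambda>\<omega>. g (X \<omega> + Y \<omega>) (X \<omega>)) borel (\<lambda>\<omega>. X \<omega> + Y \<omega>)"
  proof (rule indep_var_factorI)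
    fix A B :: "'b set" assume [measurable]: "A \<in> sets borel" "B \<in> sets borel"
    define k :: "'b \<times> 'b \<Rightarrow> ennreal"
      where "k = (\<lambda>(x, y). indicator A (g (x + y) x) * indicator B (x + y))"
    have k[measurable]: "k \<in> borel_measurable (lborel \<Otimes>\<^sub>M lborel)"
      unfolding k_def by measurable
    have "emeasure M {\<omega> \<in> space M. g (X \<omega> + Y \<omega>) (X \<omega>) \<in> A \<and> X \<omega> + Y \<omega> \<in> B} =
        (\<integral>\<^sup>+\<omega>. indicator {\<omega> \<in> space M. g (X \<omega> + Y \<omega>) (X \<omega>) \<in> A \<and> X \<omega> + Y \<omega> \<in> B} \<omega> \<partial>M)"
      by (rule nn_integral_indicator[symmetric]) measurable
    also have "\<dots> = (\<integral>\<^sup>+\<omega>. k (X \<omega>, Y \<omega>) \<partial>M)"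
      by (rule nn_integral_cong) (auto simp: k_def indicator_def)
    also have "\<dots> = (\<integral>\<^sup>+z. (case z of (x, y) \<Rightarrow> P x * Q y) * k z \<partial>(lborel \<Otimes>\<^sub>M lborel))"
      by (rule distributed_nn_integral[OF joint k, symmetric])
    also have "\<dots> = (\<integral>\<^sup>+x. \<integral>\<^sup>+y. P x * Q y * k (x, y) \<partial>lborel \<partial>lborel)"
      by (subst lborel.nn_integral_fst[symmetric]) auto
    \<comment> \<open>Translation \<open>y = v - x\<close> in the inner integral; the following
      exchange puts the fibre integral inside.\<close>
    also have "\<dots> = (\<integral>\<^sup>+x. \<integral>\<^sup>+v. P x * Q (v - x) * indicator A (g v x) * indicator B v \<partial>lborel \<partial>lborel)"
    proof (rule nn_integral_cong)
      fix x
      show "(\<integral>\<^sup>+y. P x * Q y * k (x, y) \<partial>lborel) =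
          (\<integral>\<^sup>+v. P x * Q (v - x) * indicator A (g v x) * indicator B v \<partial>lborel)"
        using nn_integral_lborel_shift[of "\<lambda>v. P x * Q (v - x) * indicator A (g v x) * indicator B v" x]
        by (simp add: k_def mult.assoc)
    qed
    also have "\<dots> = (\<integral>\<^sup>+v. \<integral>\<^sup>+x. P x * Q (v - x) * indicator A (g v x) * indicator B v \<partial>lborel \<partial>lborel)"
      by (rule lborel_pair.Fubini'[symmetric]) measurable
    also have "\<dots> = (\<integral>\<^sup>+v. (\<integral>\<^sup>+u. H u * indicator A u \<partial>lborel) * (indicator S v * c v * r v * indicator B v) \<partial>lborel)"
      by (simp add: nn_integral_multc fibre) (simp add: mult_ac)
    also have "\<dots> = (\<integral>\<^sup>+u. H u * indicator A u \<partial>lborel) *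
        (\<integral>\<^sup>+v. indicator S v * c v * r v * indicator B v \<partial>lborel)"
      by (rule nn_integral_cmult) measurable
    finally show "emeasure M {\<omega> \<in> space M. g (X \<omega> + Y \<omega>) (X \<omega>) \<in> A \<and> X \<omega> + Y \<omega> \<in> B} = \<dots>" .
  qed measurable
  moreover have "inv (w (X \<omega> + Y \<omega>)) (X \<omega>) = g (X \<omega> + Y \<omega>) (X \<omega>)" if "\<omega> \<in> space M" for \<omega>
    using sum[OF that] by (simp add: g_def)
  ultimately show ?thesis
    unfolding indep_var_distribution_eq by (simp cong: measurable_cong distr_cong)
qed

section \<open>Signs and multiplicativity of the given densities\<close>

text \<open>As \<open>ennreal\<close> truncates negative reals to 0, a constant \<open>c\<close>
  that is not positive would give total mass 0 instead of 1.\<close>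

lemma (in prob_space) density_constant_pos:
  assumes "distributed M N X (\<lambda>x. ennreal (c * F x))" "\<And>x. 0 \<le> F x"
  shows "0 < c"
proof (rule ccontr)
  assume "\<not> 0 < c"
  then have "ennreal (c * F x) = 0" for x
    using assms(2)[of x] by (simp add: ennreal_eq_0_iff mult_nonpos_nonneg)
  moreover have "X -` space N \<inter> space M = space M"
    using distributed_measurable[OF assms(1)] by (auto simp: measurable_def)
  ultimately show False
    using distributed_emeasure[OF assms(1), of "space N"] by (simp add: emeasure_space_1)
qed

lemma w_multiplicative_pos:
  assumes "w_multiplicative m e w F" "x \<in> sym_cone m"
  shows "0 < F x"
  using assms by (auto simp: w_multiplicative_def)

text \<open>Both sides equal \<open>F x * F y * F (w e u)\<close>. In this form the ratio of
  \<open>F (w x u)\<close> to \<open>F x\<close> is seen to be independent of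
  \<open>x\<close>.\<close>

lemma w_multiplicative_exchange:
  assumes F: "w_multiplicative m e w F" and w: "mult_algorithm m e w"
    and "x \<in> sym_cone m" "y \<in> sym_cone m" "u \<in> sym_cone m"
  shows "F (w x u) * F y = F (w y u) * F x"
proof -
  obtain h where h: "w_logarithmic m e w h" "\<And>z. z \<in> sym_cone m \<Longrightarrow> F z = exp (h z)"
    using F by (auto simp: w_multiplicative_def)
  have "w x u \<in> sym_cone m" "w y u \<in> sym_cone m"
    using mult_algorithm_bij(2)[OF w] assms(3-5) by blast+
  then show ?thesis
    using h assms(3-5) by (simp add: w_logarithmic_def exp_add[symmetric] algebra_simps)
      (smt (verit))
qed

theorem theorem4p1:
  fixes m :: "'a::euclidean_space \<Rightarrow> 'a \<Rightarrow> 'a" and e :: 'a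
    and w :: "'a \<Rightarrow> ('a \<Rightarrow>\<^sub>L 'a)"
    and M :: "'b measure" and X Y :: "'b \<Rightarrow> 'a"
    and CX CY :: real and \<Lambda> :: 'a and e0 f0 :: "'a \<Rightarrow> real"
  assumes "simple_eja m e"
    and "mult_algorithm m e w"
    and "w differentiable_on sym_cone m"
    and "prob_space M"
    and "\<forall>\<omega>\<in>space M. X \<omega> \<in> sym_cone m"
    and "\<forall>\<omega>\<in>space M. Y \<omega> \<in> sym_cone m"
    and "prob_space.indep_var M borel X borel Y"
    and "w_multiplicative m e w e0"
    and "w_multiplicative m e w f0"
    and "distributed M lborel X
           (\<lambda>x. ennreal (CX * e0 x * exp (\<Lambda> \<bullet> x) * indicator (sym_cone m) x))"
    and "distributed M lborel Y
           (\<lambda>x. ennreal (CY * f0 x * exp (\<Lambda> \<bullet> x) * indicator (sym_cone m) x))"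
  shows "prob_space.indep_var M
           borel (\<lambda>\<omega>. inv (blinfun_apply (w (X \<omega> + Y \<omega>))) (X \<omega>))
           borel (\<lambda>\<omega>. X \<omega> + Y \<omega>)"
proof -
  interpret prob_space M by fact
  let ?S = "sym_cone m"
  define P where "P x = CX * e0 x * exp (\<Lambda> \<bullet> x) * indicator ?S x" for x
  define Q where "Q x = CY * f0 x * exp (\<Lambda> \<bullet> x) * indicator ?S x" for x
  have eja: "eja m e"
    using assms(1) by (simp add: simple_eja_def)
  note w = mult_algorithm_bij[OF assms(2)]
  have PX: "distributed M lborel X (\<lambda>x. ennreal (P x))" and QY: "distributed M lborel Y (\<lambda>x. ennreal (Q x))"
    using assms(10,11) by (simp_all add: P_def[abs_def] Q_def[abs_def])
  note [measurable] = distributed_borel_measurable[OF PX, simplified] distributed_borel_measurable[OF QY, simplified]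
  have e0: "e0 x > 0" and f0: "f0 x > 0" if "x \<in> ?S" for x
    using w_multiplicative_pos assms(8,9) that by metis+
  have "0 < CX"
    using assms(10) by (intro density_constant_pos[of lborel X CX "\<lambda>x. e0 x * exp (\<Lambda> \<bullet> x) * indicator ?S x"])
      (auto simp: mult.assoc indicator_def less_imp_le[OF e0] intro!: mult_nonneg_nonneg)
  have "0 < CY"
    using assms(11) by (intro density_constant_pos[of lborel Y CY "\<lambda>x. f0 x * exp (\<Lambda> \<bullet> x) * indicator ?S x"])
      (auto simp: mult.assoc indicator_def less_imp_le[OF f0] intro!: mult_nonneg_nonneg)
  have P: "0 \<le> P x" and Q: "0 \<le> Q x" for x
    using \<open>0 < CX\<close> \<open>0 < CY\<close>
    by (auto simp: P_def Q_def indicator_def less_imp_le[OF e0] less_imp_le[OF f0] intro!: mult_nonneg_nonneg)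
  \<comment> \<open>A reference point: \<open>H\<close> below is the joint density along the fibre
    over \<open>v0\<close>, normalised by \<open>r v0\<close>.\<close>
  obtain v0 where v0: "v0 \<in> ?S"
    using assms(5) not_empty by blast
  \<comment> \<open>Built from \<open>P\<close> and \<open>Q\<close>, whose measurability is at
    hand. Their product carries the exponential twice, and the last factor removes one copy.\<close>
  define r where "r v = P v * Q v * exp (- \<Lambda> \<bullet> v)" for v
  define H where "H u = P (w v0 u) * Q (v0 - w v0 u) / r v0" for u
  have r: "r v = CX * CY * e0 v * f0 v * exp (\<Lambda> \<bullet> v)" if "v \<in> ?S" for v
    using that by (simp add: r_def P_def Q_def exp_minus field_simps)
  have r0: "0 < r v0"
    using v0 \<open>0 < CX\<close> \<open>0 < CY\<close> e0 f0 by (simp add: r)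
  have mem: "w v u \<in> ?S \<longleftrightarrow> u \<in> ?S" if "v \<in> ?S" for u v
    using w(1,2)[OF that] by (metis bij_is_inj inj_image_mem_iff)
  have diff: "v - w v u = w v (e - u)" if "v \<in> ?S" for u v
    using w(3)[OF that] by (simp add: blinfun.diff_right)
  have factor: "P (w v u) * Q (v - w v u) = r v * H u" if v: "v \<in> ?S" for v u
  proof (cases "u \<in> ?S \<and> e - u \<in> ?S")
    case True
    have prod: "P (w x u) * Q (x - w x u) =
        CX * CY * e0 (w x u) * f0 (w x (e - u)) * exp (\<Lambda> \<bullet> x)" if "x \<in> ?S" for x
    proof -
      \<comment> \<open>The common \<open>\<Lambda>\<close> makes the two exponents add up to one
        that no longer involves \<open>u\<close>.\<close>
      have "exp (\<Lambda> \<bullet> w x u) * exp (\<Lambda> \<bullet> w x (e - u)) = exp (\<Lambda> \<bullet> x)"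
        by (simp add: exp_add[symmetric] inner_add_right[symmetric] diff[OF that, symmetric])
      then show ?thesis
        using True that by (simp add: P_def Q_def diff mem mult_ac)
    qed
    have "e0 (w v u) * e0 v0 = e0 (w v0 u) * e0 v"
      and "f0 (w v (e - u)) * f0 v0 = f0 (w v0 (e - u)) * f0 v"
      using w_multiplicative_exchange[OF _ assms(2) v v0] assms(8,9) True by blast+
    then have "(P (w v u) * Q (v - w v u)) * r v0 = r v * (P (w v0 u) * Q (v0 - w v0 u))"
      unfolding prod[OF v] prod[OF v0] r[OF v] r[OF v0] by algebra
    then show ?thesis
      using r0 by (simp add: H_def field_simps)
  next
    case False
    \<comment> \<open>Each \<open>w x\<close> preserves the cone, so an indicator vanishes whatever
      \<open>x\<close> is; the density is zero over both \<open>v\<close> and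
      \<open>v0\<close>.\<close>
    then have zero: "P (w x u) * Q (x - w x u) = 0" if "x \<in> ?S" for x
      using that by (auto simp: P_def Q_def diff mem)
    show ?thesis
      using zero[OF v] zero[OF v0] by (simp only: H_def)
  qed
  have add: "x + y \<in> ?S" if "x \<in> ?S" "y \<in> ?S" for x y
    using sym_cone_add[OF eja assms(2)] that .
  have [measurable]: "blinfun_apply (w v0) \<in> borel_measurable borel"
    by (intro borel_measurable_continuous_onI linear_continuous_on blinfun.bounded_linear_right)
  show ?thesis
  proof (rule indep_var_density_factor[OF _ _ _ PX QY assms(7)])
    show "open ?S"
      by (simp add: sym_cone_def)
    show "continuous_on ?S w"
      by (rule differentiable_imp_continuous_on) fact
    show "X \<omega> + Y \<omega> \<in> ?S" if "\<omega> \<in> space M" for \<omega>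
      using that assms(5,6) add by blast
    show "(\<lambda>v. ennreal (P v) * ennreal (Q v) * ennreal (exp (- \<Lambda> \<bullet> v))) \<in> borel_measurable borel"
      by measurable
    show "(\<lambda>u. ennreal (P (w v0 u)) * ennreal (Q (v0 - w v0 u)) * ennreal (1 / r v0)) \<in> borel_measurable borel"
      by measurable
    show "ennreal (P (w v u)) * ennreal (Q (v - w v u)) =
        ennreal (P v) * ennreal (Q v) * ennreal (exp (- \<Lambda> \<bullet> v)) *
        (ennreal (P (w v0 u)) * ennreal (Q (v0 - w v0 u)) * ennreal (1 / r v0))" if "v \<in> ?S" for v u
      using factor[OF that, of u] P Q r0 unfolding r_def[of v] H_def
      by (simp add: ennreal_mult[symmetric])
    \<comment> \<open>If neither factor vanished, \<open>x\<close> and \<open>v - x\<close> would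
      lie in the cone, and so would their sum \<open>v\<close>.\<close>
    show "ennreal (P x) * ennreal (Q (v - x)) = 0" if "v \<notin> ?S" for v x
      using add[of x "v - x"] that by (auto simp: P_def Q_def indicator_def)
  qed (fact w(1))
qed

end
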